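(* Let $A\subset\mathbb{C}\setminus\{0\}$ be finite with $|A|=n$, and write $1/A:=\{1/a:a\in A\}$, $X+Y:=\{x+y:x\in X,y\in Y\}$. Then $$\max\{|A+A|,|1/A+1/A|\}=\Omega(n^{5/4})\quad\text{and}\quad |A+1/A|=\Omega(n^{5/4}),$$ with absolute implied constants. *)

theory Defs
  imports Complex_Main
begin

definition sumset :: "complex set \<Rightarrow> complex set \<Rightarrow> complex set" where
  "sumset X Y = {x + y | x y. x \<in> X \<and> y \<in> Y}"

definition recip_set :: "complex set \<Rightarrow> complex set" where
  "recip_set A = (\<lambda>a. 1 / a) ` A"

end

theory Submission
  imports Defs
begin

text \<open>
  The proof is a nearest neighbour argument in the style of Solymosi. Let \<open>b\<close> be the nearest
  neighbour of \<open>a\<close> in \<open>A\<close>. The truncated sector with apex \<open>b\<close> pointing towards \<open>a\<close> lies in the disc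
  around \<open>a\<close> of radius \<open>|a - b|\<close>, and these discs cover each point boundedly often. If
  \<open>|a - b| \<le> |a| / 2\<close>, the sector with apex \<open>1/b\<close> pointing towards \<open>1/a\<close> is mapped by inversion into
  the same disc. So if at least half of the points satisfy this inequality, then for most triples
  \<open>(a, d, d')\<close> the pairs \<open>(b + d, a + d)\<close> and \<open>(1/b + d', 1/a + d')\<close> consist of close elements of the
  two sumsets \<open>X\<close> and \<open>Y\<close>. There are few such pairs of pairs, and they determine the triple up to two
  choices because \<open>a - b\<close> and \<open>1/a - 1/b\<close> determine \<open>a b\<close>. This gives \<open>n\<^sup>5 \<le> C |X|\<^sup>2 |Y|\<^sup>2\<close>.
  In the remaining case half of the points are far apart relative to their moduli, and the sumsets
  even have quadratic size because adding a much smaller number leaves the summand recognisable.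
\<close>

section \<open>Sumsets\<close>

lemma card_recip_set: "card (recip_set A) = card A"
  unfolding recip_set_def by (intro card_image) (auto simp: inj_on_def)

lemma recip_recip_set [simp]: "recip_set (recip_set A) = A"
  by (force simp: recip_set_def)

lemma finite_recip_set: "finite A \<Longrightarrow> finite (recip_set A)"
  by (simp add: recip_set_def)

lemma sumset_commute: "sumset X Y = sumset Y X"
  unfolding sumset_def by (metis add.commute)

lemma finite_sumset: "finite X \<Longrightarrow> finite Y \<Longrightarrow> finite (sumset X Y)"
  by (rule finite_subset[of _ "(\<lambda>(x, y). x + y) ` (X \<times> Y)"]) (auto simp: sumset_def)

lemma sumset_mono: "X \<subseteq> X' \<Longrightarrow> Y \<subseteq> Y' \<Longrightarrow> sumset X Y \<subseteq> sumset X' Y'"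
  by (auto simp: sumset_def)

lemma card_le_sumset:
  assumes "finite X" "finite Y" "Y \<noteq> {}"
  shows "card X \<le> card (sumset X Y)"
proof -
  obtain y where "y \<in> Y" using assms by auto
  then show ?thesis
    using assms finite_sumset by (intro card_inj_on_le[of "\<lambda>x. x + y"]) (auto simp: sumset_def)
qed

section \<open>Counting by cells and sectors\<close>

lemma card_le_fibres:
  fixes k :: real
  assumes "finite S" and fib: "\<And>x. x \<in> S \<Longrightarrow> real (card {x' \<in> S. f x' = f x}) \<le> k"
  shows "real (card S) \<le> k * real (card (f ` S))"
proof -
  have "real (card S) = (\<Sum>y\<in>f ` S. real (card {x \<in> S. f x = y}))"
    using sum.image_gen[OF assms(1), of "\<lambda>_. 1 :: real" f] by simp
  also have "\<dots> \<le> (\<Sum>y\<in>f ` S. k)"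
    by (rule sum_mono) (use fib in auto)
  finally show ?thesis by (simp add: mult.commute)
qed

text \<open>A grid of side 1/4: in one cell the real and imaginary parts differ by less than 1/4
  each, hence the points by less than 1/2, the tolerance for directions below.\<close>

definition cell :: "complex \<Rightarrow> int \<times> int" where
  "cell z = (\<lfloor>4 * Re z\<rfloor>, \<lfloor>4 * Im z\<rfloor>)"

lemma cell_eq_imp_close:
  assumes "cell z = cell w"
  shows "norm (z - w) < 1/2"
proof -
  have fl: "\<bar>x - y\<bar> < 1/4" if "\<lfloor>4 * x\<rfloor> = \<lfloor>4 * y\<rfloor>" for x y :: real
    using that by linarith
  have "\<bar>Re (z - w)\<bar> < 1/4" "\<bar>Im (z - w)\<bar> < 1/4"
    using assms fl[of "Re z" "Re w"] fl[of "Im z" "Im w"] by (auto simp: cell_def)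
  then show ?thesis using cmod_le[of "z - w"] by linarith
qed

lemma cell_bounded:
  assumes "norm z \<le> of_int R"
  shows "cell z \<in> {-4*R..4*R} \<times> {-4*R..4*R}"
proof -
  have "\<bar>Re z\<bar> \<le> of_int R" "\<bar>Im z\<bar> \<le> of_int R"
    using assms abs_Re_le_cmod[of z] abs_Im_le_cmod[of z] by linarith+
  then show ?thesis unfolding cell_def by (auto simp: le_floor_iff floor_le_iff)
qed

lemma card_le_cells:
  fixes k :: real
  assumes "finite S" "0 \<le> k"
    and bd: "\<And>x. x \<in> S \<Longrightarrow> norm (f x) \<le> of_int R"
    and fib: "\<And>x. x \<in> S \<Longrightarrow> real (card {x' \<in> S. cell (f x') = cell (f x)}) \<le> k"
  shows "real (card S) \<le> k * real (nat (8 * R + 1) ^ 2)"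
proof -
  let ?I = "{-4*R..4*R} \<times> {-4*R..4*R}"
  have "card ((\<lambda>x. cell (f x)) ` S) \<le> card ?I"
    by (rule card_mono) (use bd cell_bounded in blast)+
  also have "\<dots> = nat (8 * R + 1) ^ 2"
    by (simp add: card_cartesian_product power2_eq_square algebra_simps)
  finally have "real (card ((\<lambda>x. cell (f x)) ` S)) \<le> real (nat (8 * R + 1) ^ 2)"
    by (simp only: of_nat_le_iff)
  then show ?thesis
    using card_le_fibres[OF assms(1) fib] mult_left_mono[OF _ assms(2)] by (meson order_trans)
qed

lemma norm_sgn_le_1: "norm (sgn (z :: complex)) \<le> of_int 1"
  by (simp add: norm_sgn)

text \<open>Values of \<open>sgn\<close> have norm at most 1, so they meet at most 9 * 9 cells. This
  is the source of every factor 81 below.\<close>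

lemma card_le_directions:
  fixes k :: real
  assumes "finite S" "0 \<le> k"
    and "\<And>x. x \<in> S \<Longrightarrow> real (card {x' \<in> S. cell (sgn (f x')) = cell (sgn (f x))}) \<le> k"
  shows "real (card S) \<le> 81 * k"
  using card_le_cells[of S k "\<lambda>x. sgn (f x)" 1] assms norm_sgn_le_1 by simp

text \<open>Moving radially from \<open>y\<close> costs \<open>norm y - norm x\<close>; turning at
  radius \<open>norm x\<close> costs at most \<open>norm x / 2\<close>.\<close>

lemma cone_dist_le:
  fixes x y :: complex
  assumes "norm x \<le> norm y" "norm (sgn x - sgn y) \<le> 1/2"
  shows "norm (y - x) \<le> norm y - norm x / 2"
proof -
  have polar: "z = norm z *\<^sub>R sgn z" for z :: complex
    by (cases "z = 0") (simp_all add: sgn_div_norm)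
  have "y - x = (norm y - norm x) *\<^sub>R sgn y + norm x *\<^sub>R (sgn y - sgn x)"
    using polar[of x] polar[of y] by (simp add: algebra_simps)
  then have "norm (y - x) \<le> norm ((norm y - norm x) *\<^sub>R sgn y) + norm (norm x *\<^sub>R (sgn y - sgn x))"
    by (metis norm_triangle_ineq)
  also have "\<dots> \<le> (norm y - norm x) * 1 + norm x * (1/2)"
  proof (rule add_mono)
    show "norm ((norm y - norm x) *\<^sub>R sgn y) \<le> (norm y - norm x) * 1"
      using assms(1) norm_sgn_le_1[of y] by (auto simp: norm_sgn)
    show "norm (norm x *\<^sub>R (sgn y - sgn x)) \<le> norm x * (1/2)"
      using assms(2) unfolding norm_scaleR abs_norm_cancel
      by (intro mult_left_mono) (auto simp: norm_minus_commute)
  qed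
  finally show ?thesis by simp
qed

text \<open>Directions are compared by the chord between unit vectors. For \<open>v\<close> in a
  finite set \<open>X\<close>, the number of points of \<open>X\<close> in the sector acts as the
  rank of \<open>v\<close> among the neighbours of \<open>u\<close> in its direction.\<close>

definition sector :: "complex \<Rightarrow> complex \<Rightarrow> complex set" where
  "sector u v = {z. norm (z - u) \<le> norm (v - u) \<and> norm (sgn (z - u) - sgn (v - u)) \<le> 1/2}"

lemma sector_translate: "z \<in> sector (u + d) (v + d) \<longleftrightarrow> z - d \<in> sector u v"
  by (simp add: sector_def algebra_simps)

text \<open>Within a direction class, the sector towards the farthest point contains the whole class.\<close>

lemma card_near_le:
  assumes "finite X" "0 \<le> k"
  shows "real (card {v \<in> X. real (card (X \<inter> sector u v)) \<le> k}) \<le> 81 * k"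
proof (rule card_le_directions[where f = "\<lambda>v. v - u"])
  let ?S = "{v \<in> X. real (card (X \<inter> sector u v)) \<le> k}"
  show "finite ?S" "0 \<le> k" using assms by auto
  fix x assume x: "x \<in> ?S"
  let ?C = "{x' \<in> ?S. cell (sgn (x' - u)) = cell (sgn (x - u))}"
  have C: "finite ?C" "?C \<noteq> {}" using assms x by auto
  define v where "v = arg_min_on (\<lambda>w. - norm (w - u)) ?C"
  have vC: "v \<in> ?C"
    unfolding v_def using arg_min_if_finite(1)[OF C] by blast
  have far: "norm (w - u) \<le> norm (v - u)" if "w \<in> ?C" for w
    using arg_min_least[OF C that, of "\<lambda>w. - norm (w - u)"] unfolding v_def by simp
  have "?C \<subseteq> X \<inter> sector u v"
  proof
    fix w assume w: "w \<in> ?C"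
    then have "norm (sgn (w - u) - sgn (v - u)) < 1/2"
      using vC by (intro cell_eq_imp_close) auto
    with w far[OF w] show "w \<in> X \<inter> sector u v" by (auto simp: sector_def)
  qed
  then have "card ?C \<le> card (X \<inter> sector u v)"
    using assms(1) by (intro card_mono) auto
  \<comment> \<open>Since \<open>v\<close> is itself in \<open>?S\<close>, its sector meets
    \<open>X\<close> in at most \<open>k\<close> points.\<close>
  with vC show "real (card ?C) \<le> k" by auto
qed

text \<open>Seen from \<open>z\<close>, two centres in one direction cell would be closer to each
  other than the farther one is to \<open>z\<close>, although its disc reaches \<open>z\<close> and
  its radius is at most the distance to the other centre. So each direction cell holds at most one
  centre.\<close>

lemma card_discs_through_point_le:
  fixes A :: "complex set"
  assumes "finite A" and sep: "\<And>a a'. a \<in> A \<Longrightarrow> a' \<in> A \<Longrightarrow> a \<noteq> a' \<Longrightarrow> r a \<le> dist a a'"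
  shows "real (card {a \<in> A. dist z a \<le> r a}) \<le> 81"
proof -
  let ?S = "{a \<in> A. dist z a \<le> r a}"
  have eq: "a = a'" if a: "a \<in> ?S" "a' \<in> ?S" and c: "cell (sgn (a - z)) = cell (sgn (a' - z))"
    and le: "norm (a - z) \<le> norm (a' - z)" for a a'
  proof (rule ccontr)
    assume ne: "a \<noteq> a'"
    have cl: "norm (sgn (a - z) - sgn (a' - z)) < 1/2"
      using c by (rule cell_eq_imp_close)
    have "norm (a' - a) \<le> norm (a' - z) - norm (a - z) / 2"
      using cone_dist_le[of "a - z" "a' - z"] le cl by simp
    \<comment> \<open>Together the two bounds leave only \<open>a = z\<close>; then
      \<open>sgn (a - z) = 0\<close> has distance 1 from the unit vector
      \<open>sgn (a' - z)\<close>.\<close>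
    moreover have "norm (a' - z) \<le> norm (a' - a)"
      using a sep[of a' a] ne by (auto simp: dist_norm norm_minus_commute)
    ultimately have "norm (a - z) = 0" using norm_ge_zero[of "a - z"] by argo
    then have "a = z" by simp
    with cl ne show False by (simp add: norm_sgn)
  qed
  have "real (card {a' \<in> ?S. cell (sgn (a' - z)) = cell (sgn (a - z))}) \<le> 1" if "a \<in> ?S" for a
  proof -
    have "{a' \<in> ?S. cell (sgn (a' - z)) = cell (sgn (a - z))} \<subseteq> {a}"
      using eq[of _ a] eq[of a] that by (smt (verit, del_insts) mem_Collect_eq singletonI subsetI)
    from card_mono[OF _ this] show ?thesis by simp
  qed
  from card_le_directions[of ?S 1 "\<lambda>a. a - z", OF _ _ this] show ?thesis using assms(1) by simp
qed

section \<open>The incidence bound\<close>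

text \<open>Incidences between \<open>X\<close> and the translated sectors are counted twice: a
  crowded sector contributes more than \<open>k\<close>, a point at most 81.\<close>

lemma card_crowded_sectors_le:
  assumes "finite P" "finite X"
    and ov: "\<And>z. real (card {p \<in> P. z \<in> sector (s p) (t p)}) \<le> 81"
  shows "k * real (card {p \<in> P. k < real (card (X \<inter> sector (s p + d) (t p + d)))})
           \<le> 81 * real (card X)"
proof -
  let ?N = "\<lambda>p. real (card (X \<inter> sector (s p + d) (t p + d)))"
  have "k * real (card {p \<in> P. k < ?N p}) = (\<Sum>p\<in>{p \<in> P. k < ?N p}. k)" by simp
  also have "\<dots> \<le> (\<Sum>p\<in>{p \<in> P. k < ?N p}. ?N p)" by (rule sum_mono) auto
  also have "\<dots> \<le> (\<Sum>p\<in>P. ?N p)" using assms by (intro sum_mono2) auto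
  also have "\<dots> = (\<Sum>p\<in>P. \<Sum>x\<in>X. of_bool (x \<in> sector (s p + d) (t p + d)))"
    using assms by (simp add: Int_def sum.inter_filter[symmetric])
  also have "\<dots> = (\<Sum>x\<in>X. \<Sum>p\<in>P. of_bool (x \<in> sector (s p + d) (t p + d)))"
    by (rule sum.swap)
  also have "\<dots> = (\<Sum>x\<in>X. real (card {p \<in> P. x - d \<in> sector (s p) (t p)}))"
    using assms by (simp add: Int_def sum.inter_filter[symmetric] sector_translate)
  also have "\<dots> \<le> (\<Sum>x\<in>X. 81)" using ov by (intro sum_mono) auto
  finally show ?thesis by simp
qed

text \<open>Counts triples of two translations and an index \<open>p\<close> whose two translated
  pairs are both uncrowded. At least half of all triples qualify, their images under
  \<open>F\<close> are few, and \<open>F\<close> is at most two-to-one by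
  \<open>fib\<close>.\<close>

lemma incidence_bound:
  fixes s t s' t' :: "'p \<Rightarrow> complex"
  assumes fin: "finite P" "finite D" "finite D'" "finite X" "finite Y"
    and ov: "\<And>z. real (card {p \<in> P. z \<in> sector (s p) (t p)}) \<le> 81"
    and ov': "\<And>z. real (card {p \<in> P. z \<in> sector (s' p) (t' p)}) \<le> 81"
    and X: "\<And>p d. p \<in> P \<Longrightarrow> d \<in> D \<Longrightarrow> s p + d \<in> X \<and> t p + d \<in> X"
    and Y: "\<And>p d. p \<in> P \<Longrightarrow> d \<in> D' \<Longrightarrow> s' p + d \<in> Y \<and> t' p + d \<in> Y"
    and fib: "\<And>p. p \<in> P \<Longrightarrow>
      real (card {q \<in> P. t q - s q = t p - s p \<and> t' q - s' q = t' p - s' p}) \<le> 2"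
  shows "real (card P) ^ 3 * real (card D) * real (card D')
           \<le> 4 * 26244 ^ 2 * (real (card X) * real (card Y)) ^ 2"
proof (cases "P = {} \<or> D = {} \<or> D' = {}")
  case True
  then show ?thesis by auto
next
  case False
  define n where "n = real (card P)"
  have n: "n > 0" using False fin by (auto simp: n_def card_gt_0_iff)
  have Xpos: "real (card X) > 0" and Ypos: "real (card Y) > 0"
    using False X Y fin by (fastforce simp: card_gt_0_iff)+
  \<comment> \<open>As 324 = 4 * 81, each translation makes at most a quarter of \<open>P\<close>
    crowded in \<open>X\<close>, and likewise in \<open>Y\<close>, so half of \<open>P\<close>
    survives both.\<close>
  define k where "k = 324 * real (card X) / n"
  define k' where "k' = 324 * real (card Y) / n"
  have k: "k > 0" "k' > 0" using n Xpos Ypos by (auto simp: k_def k'_def)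
  let ?bad = "\<lambda>d. {p \<in> P. k < real (card (X \<inter> sector (s p + d) (t p + d)))}"
  let ?bad' = "\<lambda>d. {p \<in> P. k' < real (card (Y \<inter> sector (s' p + d) (t' p + d)))}"
  have bad: "real (card (?bad d)) \<le> n / 4" for d
    using card_crowded_sectors_le[OF fin(1,4) ov, of k d] n Xpos
    by (simp add: k_def field_simps)
  have bad': "real (card (?bad' d)) \<le> n / 4" for d
    using card_crowded_sectors_le[OF fin(1,5) ov', of k' d] n Ypos
    by (simp add: k'_def field_simps)
  define G where "G d d' = P - ?bad d - ?bad' d'" for d d'
  have G: "n / 2 \<le> real (card (G d d'))" for d d'
  proof -
    have "card P \<le> card (G d d' \<union> (?bad d \<union> ?bad' d'))"
      using fin by (intro card_mono) (auto simp: G_def)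
    also have "\<dots> \<le> card (G d d') + (card (?bad d) + card (?bad' d'))"
      by (meson add_left_mono card_Un_le order_trans)
    finally have "n \<le> real (card (G d d') + (card (?bad d) + card (?bad' d')))"
      unfolding n_def by (simp only: of_nat_le_iff)
    then show ?thesis using bad[of d] bad'[of d'] by simp
  qed
  define T where "T = (SIGMA e : D \<times> D'. G (fst e) (snd e))"
  have finT: "finite T" using fin by (auto simp: T_def G_def)
  have "real (card D) * real (card D') * (n / 2) = (\<Sum>e\<in>D \<times> D'. n / 2)"
    by (simp add: card_cartesian_product)
  also have "\<dots> \<le> (\<Sum>e\<in>D \<times> D'. real (card (G (fst e) (snd e))))"
    using G by (intro sum_mono) auto
  also have "\<dots> = real (card T)"
    using fin by (subst T_def, subst card_SigmaI) (auto simp: G_def)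
  finally have T_ge: "real (card D) * real (card D') * (n / 2) \<le> real (card T)" .

  \<comment> \<open>The first entry of each pair is the apex; by \<open>card_near_le\<close> it has
    at most \<open>81 * k\<close> (or \<open>81 * k'\<close>) uncrowded partners.\<close>
  define F where "F = (\<lambda>((d, d'), p). ((s p + d, t p + d), (s' p + d', t' p + d')))"
  let ?XX = "SIGMA u : X. {v \<in> X. real (card (X \<inter> sector u v)) \<le> k}"
  let ?YY = "SIGMA u : Y. {v \<in> Y. real (card (Y \<inter> sector u v)) \<le> k'}"
  have XX: "real (card ?XX) \<le> real (card X) * (81 * k)"
  proof -
    have "real (card ?XX) = (\<Sum>u\<in>X. real (card {v \<in> X. real (card (X \<inter> sector u v)) \<le> k}))"
      using fin by (subst card_SigmaI) auto
    also have "\<dots> \<le> (\<Sum>u\<in>X. 81 * k)"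
      using fin k card_near_le by (intro sum_mono) auto
    finally show ?thesis by simp
  qed
  have YY: "real (card ?YY) \<le> real (card Y) * (81 * k')"
  proof -
    have "real (card ?YY) = (\<Sum>u\<in>Y. real (card {v \<in> Y. real (card (Y \<inter> sector u v)) \<le> k'}))"
      using fin by (subst card_SigmaI) auto
    also have "\<dots> \<le> (\<Sum>u\<in>Y. 81 * k')"
      using fin k card_near_le by (intro sum_mono) auto
    finally show ?thesis by simp
  qed
  have "F ` T \<subseteq> ?XX \<times> ?YY"
    using X Y by (auto simp: F_def T_def G_def not_less)
  then have "card (F ` T) \<le> card (?XX \<times> ?YY)"
    using fin by (intro card_mono) auto
  then have "real (card (F ` T)) \<le> real (card ?XX) * real (card ?YY)"
    unfolding card_cartesian_product of_nat_mult[symmetric] of_nat_le_iff .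
  also have "\<dots> \<le> (real (card X) * (81 * k)) * (real (card Y) * (81 * k'))"
    using XX YY k by (intro mult_mono) auto
  finally have img: "real (card (F ` T)) \<le> (real (card X) * (81 * k)) * (real (card Y) * (81 * k'))" .

  have "real (card {x' \<in> T. F x' = F x}) \<le> 2" if x: "x \<in> T" for x
  proof -
    obtain d d' p where xe: "x = ((d, d'), p)" by (metis surj_pair)
    let ?Q = "{q \<in> P. t q - s q = t p - s p \<and> t' q - s' q = t' p - s' p}"
    \<comment> \<open>Given the index, the image fixes both translations by cancellation. The index
      itself lies in \<open>?Q\<close> because translations drop out of the differences.\<close>
    have "inj_on snd {x' \<in> T. F x' = F x}"
      by (intro inj_onI) (auto simp: F_def xe, (metis add_left_imp_eq)+)
    moreover have diff: "v - u = v' - u'" if "u + e = u' + e'" "v + e = v' + e'"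
      for u v u' v' e e' :: complex
      using that by (metis add_diff_cancel_right)
    have "snd ` {x' \<in> T. F x' = F x} \<subseteq> ?Q"
    proof
      fix q assume "q \<in> snd ` {x' \<in> T. F x' = F x}"
      then obtain e e' where "((e, e'), q) \<in> T" "F ((e, e'), q) = F x" by auto
      then have "q \<in> P" "s q + e = s p + d" "t q + e = t p + d"
        "s' q + e' = s' p + d'" "t' q + e' = t' p + d'"
        by (auto simp: F_def xe T_def G_def)
      then show "q \<in> ?Q" using diff by blast
    qed
    ultimately have "card {x' \<in> T. F x' = F x} \<le> card ?Q"
      using fin by (intro card_inj_on_le) auto
    moreover have "real (card ?Q) \<le> 2" using fib x by (auto simp: xe T_def G_def)
    ultimately show ?thesis by linarith
  qed
  from card_le_fibres[OF finT this]
  have "real (card T) \<le> 2 * real (card (F ` T))" .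
  with T_ge img have "real (card D) * real (card D') * (n / 2)
      \<le> 2 * ((real (card X) * (81 * k)) * (real (card Y) * (81 * k')))"
    by linarith
  \<comment> \<open>Here 26244 = 81 * 324.\<close>
  also have "\<dots> = 2 * 26244 ^ 2 * (real (card X) * real (card Y)) ^ 2 / n ^ 2"
    using n by (simp add: k_def k'_def power2_eq_square field_simps)
  finally show ?thesis
    using n unfolding n_def[symmetric]
    by (simp add: field_simps power2_eq_square power3_eq_cube)
qed

section \<open>Nearest neighbours\<close>

lemma sector_subset_cball:
  assumes "z \<in> sector b a"
  shows "dist z a \<le> dist a b"
proof -
  have "norm ((a - b) - (z - b)) \<le> norm (a - b) - norm (z - b) / 2"
    using assms by (intro cone_dist_le) (auto simp: sector_def)
  then show ?thesis
    using norm_ge_zero[of "z - b"] by (simp add: dist_norm norm_minus_commute del: norm_ge_zero)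
qed

text \<open>The saving \<open>norm x / 2\<close> in the cone estimate pays for the distortion of
  inversion: \<open>close\<close> says \<open>norm y * norm b \<le> 1/2\<close>, so the saving is at
  least \<open>norm x * norm y * norm b\<close>, while \<open>w * b = 1 + x * b\<close> bounds
  \<open>norm w * norm b\<close> below by \<open>1 - norm x * norm b\<close>.\<close>

lemma inverse_sector_subset_cball:
  fixes a b w :: complex
  assumes nz: "a \<noteq> 0" "b \<noteq> 0" and close: "dist a b \<le> norm a / 2" and w: "w \<in> sector (1/b) (1/a)"
  shows "dist (1/w) a \<le> dist a b"
proof -
  define x where "x = w - 1/b"
  define y where "y = 1/a - 1/b"
  have le: "norm x \<le> norm y" and "norm (y - x) \<le> norm y - norm x / 2"
    using w cone_dist_le[of x y] by (auto simp: sector_def x_def y_def)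
  have "y = (b - a) / (a * b)" using nz by (simp add: y_def field_simps)
  then have ny: "norm y * (norm a * norm b) = dist a b"
    using nz by (simp add: norm_divide norm_mult dist_norm norm_minus_commute)
  have "norm y * norm b \<le> 1/2"
  proof -
    have "norm a * (norm y * norm b) \<le> norm a * (1/2)" using ny close by (simp add: mult_ac)
    then show ?thesis using nz by (subst (asm) mult_le_cancel_left_pos) auto
  qed
  moreover have "norm x * norm b \<le> norm y * norm b" using le by (simp add: mult_right_mono)
  ultimately have xb: "norm x * norm b \<le> 1/2" by linarith
  have "w * b = 1 + x * b" using nz by (simp add: x_def field_simps)
  then have wb: "norm w * norm b \<ge> 1 - norm x * norm b"
    by (metis norm_diff_ineq norm_mult norm_one)
  with xb have w0: "w \<noteq> 0" by auto
  have "norm (y - x) \<le> norm y - norm x * (norm y * norm b)"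
    using \<open>norm (y - x) \<le> norm y - norm x / 2\<close> mult_left_mono[OF \<open>norm y * norm b \<le> 1/2\<close>, of "norm x"]
    by simp
  also have "\<dots> = (1 - norm x * norm b) * norm y" by (simp add: algebra_simps)
  also have "\<dots> \<le> norm w * norm b * norm y" using wb by (intro mult_right_mono) auto
  finally have main: "norm (y - x) \<le> norm w * norm b * norm y" .
  have "1/w - a = a * (y - x) / w" using nz w0 by (simp add: x_def y_def field_simps)
  then have "dist (1/w) a = norm a * norm (y - x) / norm w"
    by (simp add: dist_norm norm_mult norm_divide)
  also have "\<dots> \<le> norm a * (norm w * norm b * norm y) / norm w"
    using main by (intro divide_right_mono mult_left_mono) auto
  also have "\<dots> = dist a b" using w0 ny by (simp add: field_simps)
  finally show ?thesis .
qed

text \<open>\<open>a - b\<close> and \<open>1/a - 1/b\<close> determine \<open>a * b\<close>, so \<open>a\<close> is a root of a known quadratic.\<close>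

lemma differences_determine_pair:
  fixes a b a' b' :: complex
  assumes "a \<noteq> 0" "b \<noteq> 0" "a' \<noteq> 0" "b' \<noteq> 0" "a \<noteq> b"
    and d: "a' - b' = a - b" and e: "1/a' - 1/b' = 1/a - 1/b"
  shows "a' = a \<or> a' = - b"
proof -
  have "(b' - a') * (a * b) = (b - a) * (a' * b')"
    using e assms by (simp add: field_simps)
  moreover have "b' - a' = b - a" using d by (simp add: algebra_simps)
  ultimately have "a * b = a' * b'" using assms by auto
  moreover have "b' = a' - (a - b)" using d by (simp add: algebra_simps)
  \<comment> \<open>This is the quadratic \<open>a'\<^sup>2 - (a - b) a' - a b = 0\<close> in
    factored form.\<close>
  ultimately have "(a' - a) * (a' + b) = 0" by (simp add: algebra_simps)
  then show ?thesis by (auto simp: add_eq_0_iff2)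
qed

text \<open>Applies the incidence bound to the pairs \<open>(nn a, a)\<close> and their reciprocals.
  \<open>D\<close> and \<open>D'\<close> stay free so that \<open>A\<close> and \<open>1/A\<close>,
  in either order, yield both halves of the theorem.\<close>

lemma clustered_bound:
  fixes A D D' :: "complex set" and nn :: "complex \<Rightarrow> complex"
  assumes fin: "finite A" "finite D" "finite D'" and nz: "0 \<notin> A"
    and nn: "\<And>a. a \<in> A \<Longrightarrow> nn a \<in> A \<and> nn a \<noteq> a"
    and nearest: "\<And>a a'. a \<in> A \<Longrightarrow> a' \<in> A \<Longrightarrow> a \<noteq> a' \<Longrightarrow> dist a (nn a) \<le> dist a a'"
    and P: "P \<subseteq> A" "\<And>a. a \<in> P \<Longrightarrow> dist a (nn a) \<le> norm a / 2"
  shows "real (card P) ^ 3 * real (card D) * real (card D')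
     \<le> 4 * 26244 ^ 2 * (real (card (sumset A D)) * real (card (sumset (recip_set A) D'))) ^ 2"
proof (rule incidence_bound[where s = nn and t = "\<lambda>a. a" and s' = "\<lambda>a. 1 / nn a" and t' = "\<lambda>a. 1 / a"])
  have finP: "finite P" using P fin finite_subset by auto
  show "finite P" "finite D" "finite D'" "finite (sumset A D)" "finite (sumset (recip_set A) D')"
    using fin finP by (auto intro: finite_sumset finite_recip_set)
  have discs: "real (card {a \<in> P. dist z a \<le> dist a (nn a)}) \<le> 81" for z
    using P(1) nearest by (intro card_discs_through_point_le[OF finP]) (meson subsetD)
  have nz': "a \<noteq> 0 \<and> nn a \<noteq> 0" if "a \<in> P" for a using that P(1) nz nn by (metis subsetD)
  show "real (card {p \<in> P. z \<in> sector (nn p) p}) \<le> 81" for z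
  proof -
    have "card {p \<in> P. z \<in> sector (nn p) p} \<le> card {a \<in> P. dist z a \<le> dist a (nn a)}"
      using finP sector_subset_cball by (intro card_mono) auto
    then show ?thesis using discs[of z] by linarith
  qed
  show "real (card {p \<in> P. z \<in> sector (1 / nn p) (1 / p)}) \<le> 81" for z
  proof -
    \<comment> \<open>Inversion carries these sectors into the same discs, now tested at the point
      \<open>1/z\<close>.\<close>
    have "card {p \<in> P. z \<in> sector (1 / nn p) (1 / p)} \<le> card {a \<in> P. dist (1/z) a \<le> dist a (nn a)}"
      using finP inverse_sector_subset_cball P(2) nz' by (intro card_mono) auto
    then show ?thesis using discs[of "1/z"] by linarith
  qed
  show "nn p + d \<in> sumset A D \<and> p + d \<in> sumset A D" if "p \<in> P" "d \<in> D" for p d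
    using that P nn unfolding sumset_def by blast
  show "1 / nn p + d \<in> sumset (recip_set A) D' \<and> 1 / p + d \<in> sumset (recip_set A) D'"
    if "p \<in> P" "d \<in> D'" for p d
    using that P nn unfolding sumset_def recip_set_def by blast
  fix p assume p: "p \<in> P"
  have "{q \<in> P. q - nn q = p - nn p \<and> 1 / q - 1 / nn q = 1 / p - 1 / nn p} \<subseteq> {p, - nn p}"
    using differences_determine_pair nz' p nn P(1) by (smt (verit, best) insertCI mem_Collect_eq subsetD subsetI)
  from card_mono[OF _ this]
  show "real (card {q \<in> P. q - nn q = p - nn p \<and> 1 / q - 1 / nn q = 1 / p - 1 / nn p}) \<le> 2"
    using card_insert_le_m1[of 2 "{- nn p}" p] by simp
qed

section \<open>Separated sets\<close>

text \<open>The gap is measured relative to the modulus, which makes the condition invariant under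
  scaling and, away from 0, under inversion.\<close>

definition separated :: "complex set \<Rightarrow> bool" where
  "separated U \<longleftrightarrow> (\<forall>x\<in>U. \<forall>x'\<in>U. x \<noteq> x' \<longrightarrow> norm x \<le> 2 * dist x x')"

lemma separated_subset: "separated U \<Longrightarrow> V \<subseteq> U \<Longrightarrow> separated V"
  by (auto simp: separated_def)

text \<open>Since \<open>1/a - 1/a' = (a' - a) / (a * a')\<close>, the condition at
  \<open>1/a\<close> is the one at \<open>a'\<close>.\<close>

lemma separated_recip_set:
  assumes "separated U" "0 \<notin> U"
  shows "separated (recip_set U)"
  unfolding separated_def recip_set_def
proof (intro ballI impI, elim imageE)
  fix x x' a a' assume *: "x \<noteq> x'" "x = 1 / a" "x' = 1 / a'" "a \<in> U" "a' \<in> U"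
  then have nz: "a \<noteq> 0" "a' \<noteq> 0" using assms by auto
  have "x - x' = (a' - a) / (a * a')" using nz * by (simp add: field_simps)
  then have d: "dist x x' = dist a' a / (norm a * norm a')"
    by (simp add: dist_norm norm_divide norm_mult)
  have "norm a' \<le> 2 * dist a' a" using * assms by (auto simp: separated_def)
  then have "norm a' / (norm a * norm a') \<le> 2 * dist a' a / (norm a * norm a')"
    by (intro divide_right_mono) auto
  then show "norm x \<le> 2 * dist x x'" using nz d * by (simp add: norm_divide)
qed

text \<open>Dividing by \<open>norm y\<close> puts the points into the disc of radius 4 with gaps of
  at least 1/2, hence into distinct cells; 1089 = 33 * 33 with 33 = 8 * 4 + 1.\<close>

lemma separated_annulus_card_le:
  assumes "finite U" "separated U" "y \<noteq> 0"
  shows "card {x \<in> U. norm y \<le> norm x \<and> norm x \<le> 4 * norm y} \<le> 1089"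
proof -
  let ?S = "{x \<in> U. norm y \<le> norm x \<and> norm x \<le> 4 * norm y}"
  let ?f = "\<lambda>x. x / of_real (norm y)"
  have eq: "x = x'" if "x \<in> ?S" "x' \<in> ?S" "cell (?f x) = cell (?f x')" for x x'
  proof (rule ccontr)
    assume ne: "x \<noteq> x'"
    have "?f x - ?f x' = (x - x') / of_real (norm y)" by (simp add: diff_divide_distrib)
    then have "norm (x - x') / norm y < 1/2"
      using cell_eq_imp_close[OF that(3)] by (simp add: norm_divide)
    then have "2 * norm (x - x') < norm y" using assms(3) by (simp add: field_simps)
    moreover have "norm x \<le> 2 * norm (x - x')"
      using that ne assms(2) by (auto simp: separated_def dist_norm)
    moreover have "norm y \<le> norm x" using that by simp
    ultimately show False by linarith
  qed
  have "real (card ?S) \<le> 1 * real (nat (8 * 4 + 1) ^ 2)"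
  proof (rule card_le_cells[where f = ?f])
    fix x assume x: "x \<in> ?S"
    show "norm (?f x) \<le> of_int 4" using x assms(3) by (simp add: norm_divide field_simps)
    have "{x' \<in> ?S. cell (?f x') = cell (?f x)} \<subseteq> {x}" using eq x by blast
    from card_mono[OF _ this] show "real (card {x' \<in> ?S. cell (?f x') = cell (?f x)}) \<le> 1" by simp
  qed (use assms in auto)
  then show ?thesis by simp
qed

text \<open>If \<open>4 * norm y < norm x\<close>, the sum determines the pair; the other pairs lie
  in an annulus, at most 1089 for each \<open>y\<close>.\<close>

lemma card_sumset_separated:
  assumes fin: "finite U" "finite Y" and sep: "separated U" and "0 \<notin> Y"
  shows "card {(x, y) \<in> U \<times> Y. norm y \<le> norm x} \<le> card (sumset U Y) + 1089 * card Y"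
proof -
  let ?Q1 = "{(x, y) \<in> U \<times> Y. 4 * norm y < norm x}"
  let ?Q2 = "\<lambda>y. {x \<in> U. norm y \<le> norm x \<and> norm x \<le> 4 * norm y}"
  have "inj_on (\<lambda>(x, y). x + y) ?Q1"
  proof (rule inj_onI, clarsimp)
    fix x y x' y' :: complex
    assume *: "x \<in> U" "x' \<in> U" "4 * norm y < norm x" "4 * norm y' < norm x'" "x + y = x' + y'"
    have "x - x' = y' - y" using *(5) by (simp add: algebra_simps)
    then have tri: "norm (x - x') \<le> norm y' + norm y" by (metis norm_triangle_ineq4)
    \<comment> \<open>Otherwise \<open>norm (x - x') \<le> norm y + norm y' < (norm x + norm x') / 4
      \<le> norm (x - x')\<close>.\<close>
    have "x = x'"
    proof (rule ccontr)
      assume "x \<noteq> x'"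
      then have "norm x \<le> 2 * norm (x - x')" "norm x' \<le> 2 * norm (x' - x)"
        using sep *(1,2) by (auto simp: separated_def dist_norm)
      then show False using tri *(3,4) by (simp add: norm_minus_commute)
    qed
    with * show "x = x' \<and> y = y'" by simp
  qed
  moreover have "(\<lambda>(x, y). x + y) ` ?Q1 \<subseteq> sumset U Y" by (auto simp: sumset_def)
  moreover have "finite (sumset U Y)" using fin by (rule finite_sumset)
  ultimately have Q1: "card ?Q1 \<le> card (sumset U Y)" by (rule card_inj_on_le)
  have "card (SIGMA y : Y. ?Q2 y) = (\<Sum>y\<in>Y. card (?Q2 y))"
    using fin by (intro card_SigmaI) auto
  also have "\<dots> \<le> (\<Sum>y\<in>Y. 1089)"
    using assms by (intro sum_mono separated_annulus_card_le) auto
  finally have Q2: "card (prod.swap ` (SIGMA y : Y. ?Q2 y)) \<le> 1089 * card Y"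
    by (subst card_image) auto
  have "{(x, y) \<in> U \<times> Y. norm y \<le> norm x} \<subseteq> ?Q1 \<union> prod.swap ` (SIGMA y : Y. ?Q2 y)"
    by (force simp: image_iff)
  moreover have "finite ?Q1" by (rule finite_subset[of _ "U \<times> Y"]) (use fin in auto)
  ultimately have "card {(x, y) \<in> U \<times> Y. norm y \<le> norm x}
      \<le> card (?Q1 \<union> prod.swap ` (SIGMA y : Y. ?Q2 y))"
    using fin by (intro card_mono) auto
  also have "\<dots> \<le> card ?Q1 + card (prod.swap ` (SIGMA y : Y. ?Q2 y))" by (rule card_Un_le)
  finally show ?thesis using Q1 Q2 by linarith
qed

text \<open>Every pair or its swap has its second entry no larger in norm than its first, whence the
  factor 2.\<close>

lemma card_sumset_self_separated:
  assumes fin: "finite U" and "separated U" "0 \<notin> U"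
  shows "card U ^ 2 \<le> 2 * (card (sumset U U) + 1089 * card U)"
proof -
  let ?Q = "{(x, y) \<in> U \<times> U. norm y \<le> norm x}"
  have finQ: "finite ?Q" by (rule finite_subset[of _ "U \<times> U"]) (use fin in auto)
  have "card U ^ 2 = card (U \<times> U)" by (simp add: card_cartesian_product power2_eq_square)
  also have "\<dots> \<le> card (?Q \<union> prod.swap ` ?Q)"
    using finQ by (intro card_mono) (auto simp: image_iff)
  also have "\<dots> \<le> card ?Q + card (prod.swap ` ?Q)" by (rule card_Un_le)
  also have "\<dots> \<le> 2 * card ?Q" using card_image_le[OF finQ, of prod.swap] by simp
  finally show ?thesis using card_sumset_separated[OF fin fin] assms by fastforce
qed

text \<open>No reciprocal exceeds 1 in norm and no element of \<open>U\<close> is below 1, so every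
  pair is counted.\<close>

lemma card_sumset_recip_separated:
  assumes fin: "finite U" and "separated U" and large: "\<And>x. x \<in> U \<Longrightarrow> norm x \<ge> 1"
  shows "card U ^ 2 \<le> card (sumset U (recip_set U)) + 1089 * card U"
proof -
  have nz: "0 \<notin> U" using large by fastforce
  have "norm y \<le> norm x" if "x \<in> U" "y \<in> recip_set U" for x y
  proof -
    from that obtain a where a: "a \<in> U" "y = 1 / a" by (auto simp: recip_set_def)
    then have "norm y \<le> 1" using large[of a] by (simp add: norm_divide divide_le_eq)
    then show ?thesis using large[OF that(1)] by linarith
  qed
  then have "{(x, y) \<in> U \<times> recip_set U. norm y \<le> norm x} = U \<times> recip_set U" by auto
  moreover have "finite (recip_set U)" "0 \<notin> recip_set U"
    using fin nz by (auto simp: recip_set_def)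
  ultimately show ?thesis
    using card_sumset_separated[of U "recip_set U"] assms(1,2)
    by (simp add: card_recip_set card_cartesian_product power2_eq_square)
qed

section \<open>Lower bounds for both sumsets\<close>

lemma powr_bound_of_power_bound:
  fixes n m :: nat
  assumes "real n ^ 5 \<le> 400 ^ 4 * real m ^ 4"
  shows "1/400 * real n powr (5/4) \<le> real m"
proof (cases "n = 0")
  case False
  have "(real n powr (5/4)) ^ 4 = (real n powr (5/4)) powr real 4"
    using False by (intro powr_realpow[symmetric]) simp
  also have "\<dots> = real n powr real 5" by (simp add: powr_powr)
  also have "\<dots> = real n ^ 5" using False by (intro powr_realpow) simp
  also have "\<dots> \<le> (400 * real m) ^ 4" using assms by (simp add: power_mult_distrib)
  finally have "real n powr (5/4) \<le> 400 * real m"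
    by (subst (asm) power_mono_iff) simp_all
  then show ?thesis by simp
qed simp

text \<open>For \<open>n > 17424 = 4 * 4356\<close> the hypothesis \<open>n \<le> 4 * t\<close>
  gives \<open>t > 4356 = 4 * 1089\<close>, so the linear term is absorbed and
  \<open>n\<^sup>2 \<le> 64 m\<close>. Smaller \<open>n\<close> are covered by
  \<open>n \<le> m\<close> and the constant.\<close>

lemma power_bound_of_quadratic:
  fixes n m t :: nat
  assumes "n \<le> 4 * t" "n \<le> m" and quad: "t ^ 2 \<le> 2 * (m + 1089 * t)"
  shows "real n ^ 5 \<le> 400 ^ 4 * real m ^ 4"
proof (cases "n \<le> 17424")
  case True
  have "real n ^ 5 = real n * real n ^ 4" by (simp add: power_numeral_reduce)
  also have "\<dots> \<le> 400 ^ 4 * real m ^ 4"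
    using True assms by (intro mult_mono power_mono) auto
  finally show ?thesis .
next
  case False
  have "4356 * t \<le> t ^ 2" using False assms by (simp add: power2_eq_square)
  moreover have "2 * t ^ 2 \<le> 4 * m + 4356 * t" using quad by simp
  ultimately have "t ^ 2 \<le> 4 * m" by linarith
  moreover have "n ^ 2 \<le> (4 * t) ^ 2" using assms by (intro power_mono) auto
  ultimately have "n ^ 2 \<le> 64 * m" by (simp add: power_mult_distrib)
  then have "real n ^ 2 \<le> 64 * real m"
    by (metis of_nat_le_iff of_nat_mult of_nat_numeral of_nat_power)
  then have "(real n ^ 2) ^ 4 \<le> (64 * real m) ^ 4" by (intro power_mono) auto
  then have "real n ^ 8 \<le> 64 ^ 4 * real m ^ 4" by (simp add: power_mult_distrib flip: power_mult)
  moreover have "real n ^ 5 \<le> real n ^ 8" using False by (intro power_increasing) auto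
  ultimately show ?thesis by (simp add: algebra_simps) (smt (verit) zero_le_power of_nat_0_le_iff)
qed

lemma separated_case:
  assumes fin: "finite A" and nz: "0 \<notin> A" and "B \<subseteq> A" "separated B" and half: "card A \<le> 2 * card B"
  shows "real (card A) ^ 5 \<le> 400 ^ 4 * real (card (sumset A A)) ^ 4"
    and "real (card A) ^ 5 \<le> 400 ^ 4 * real (card (sumset A (recip_set A))) ^ 4"
proof -
  have finB: "finite B" using assms finite_subset by auto
  have nzB: "0 \<notin> B" using assms by auto
  have finR: "finite (recip_set A)" using fin by (rule finite_recip_set)
  have neR: "recip_set A \<noteq> {}" if "A \<noteq> {}" using that by (simp add: recip_set_def)
  have le: "card A \<le> card (sumset A A)" "card A \<le> card (sumset A (recip_set A))"
    using card_le_sumset[OF fin fin] card_le_sumset[OF fin finR] neR by (cases "A = {}"; simp)+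
  have "card (sumset B B) \<le> card (sumset A A)"
    using fin finite_sumset assms sumset_mono by (intro card_mono) auto
  then show "real (card A) ^ 5 \<le> 400 ^ 4 * real (card (sumset A A)) ^ 4"
    using card_sumset_self_separated[OF finB assms(4) nzB] half le
    by (intro power_bound_of_quadratic[where t = "card B"]) auto
  \<comment> \<open>Splitting at modulus 1 and inverting the small part gives two sets outside the
    open unit disc; the larger has at least half the size of \<open>B\<close>.\<close>
  define U1 where "U1 = {a \<in> B. norm a \<ge> 1}"
  define U2 where "U2 = recip_set {a \<in> B. norm a \<le> 1}"
  have "card B \<le> card (U1 \<union> {a \<in> B. norm a \<le> 1})"
    using finB by (intro card_mono) (auto simp: U1_def)
  also have "\<dots> \<le> card U1 + card U2"
    unfolding U2_def card_recip_set by (rule card_Un_le)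
  finally have UB: "card B \<le> card U1 + card U2" .
  have concl: "real (card A) ^ 5 \<le> 400 ^ 4 * real (card (sumset A (recip_set A))) ^ 4"
    if "finite U" "separated U" "\<And>x. x \<in> U \<Longrightarrow> norm x \<ge> 1" "card B \<le> 2 * card U"
      "sumset U (recip_set U) \<subseteq> sumset A (recip_set A)" for U
  proof (rule power_bound_of_quadratic[where t = "card U"])
    have "card (sumset U (recip_set U)) \<le> card (sumset A (recip_set A))"
      using that fin finR finite_sumset by (intro card_mono) auto
    then show "card U ^ 2 \<le> 2 * (card (sumset A (recip_set A)) + 1089 * card U)"
      using card_sumset_recip_separated[OF that(1,2)] that(3) by fastforce
  qed (use le half that in auto)
  have rm: "recip_set X \<subseteq> recip_set X'" if "X \<subseteq> X'" for X X'
    using that by (auto simp: recip_set_def)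
  show "real (card A) ^ 5 \<le> 400 ^ 4 * real (card (sumset A (recip_set A))) ^ 4"
  proof (cases "card U2 \<le> card U1")
    case True
    show ?thesis
    proof (rule concl[of U1])
      have "U1 \<subseteq> A" using assms by (auto simp: U1_def)
      then show "sumset U1 (recip_set U1) \<subseteq> sumset A (recip_set A)"
        by (intro sumset_mono rm)
      show "separated U1" using assms by (auto simp: U1_def intro: separated_subset)
    qed (use finB True UB in \<open>auto simp: U1_def\<close>)
  next
    case False
    show ?thesis
    proof (rule concl[of U2])
      \<comment> \<open>Inverting the part exchanges the two summands, and \<open>A + 1/A\<close> is
        symmetric under this.\<close>
      have "{a \<in> B. norm a \<le> 1} \<subseteq> A" using assms by auto
      then have "sumset U2 (recip_set U2) \<subseteq> sumset (recip_set A) A"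
        unfolding U2_def recip_recip_set by (intro sumset_mono rm)
      then show "sumset U2 (recip_set U2) \<subseteq> sumset A (recip_set A)"
        by (simp add: sumset_commute)
      show "separated U2" unfolding U2_def
        using nzB by (intro separated_recip_set separated_subset[OF assms(4)]) auto
      show "norm x \<ge> 1" if "x \<in> U2" for x
      proof -
        from that obtain a where "a \<in> B" "norm a \<le> 1" "x = 1 / a"
          by (auto simp: U2_def recip_set_def)
        then show ?thesis using nzB by (auto simp: norm_divide le_divide_eq)
      qed
    qed (use finB False UB in \<open>auto simp: U2_def recip_set_def\<close>)
  qed
qed

lemma power_bound_of_product:
  fixes n p x y m :: real
  assumes "0 \<le> n" "n \<le> 2 * p" "0 \<le> x" "0 \<le> y" "x \<le> m" "y \<le> m"
    and "p ^ 3 * n * n \<le> 4 * 26244 ^ 2 * (x * y) ^ 2"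
  shows "n ^ 5 \<le> 400 ^ 4 * m ^ 4"
proof -
  have "n ^ 5 = n ^ 3 * n * n" by (simp add: power_numeral_reduce)
  also have "\<dots> \<le> (2 * p) ^ 3 * n * n" using assms by (intro mult_right_mono power_mono) auto
  also have "\<dots> \<le> 8 * (4 * 26244 ^ 2 * (x * y) ^ 2)"
    using mult_left_mono[OF assms(7), of 8] by (simp only: power_mult_distrib) (simp add: mult_ac)
  also have "\<dots> \<le> 8 * (4 * 26244 ^ 2 * (m * m) ^ 2)"
    using assms by (intro mult_left_mono power_mono mult_mono) auto
  also have "\<dots> = 8 * 4 * 26244 ^ 2 * m ^ 4" by (simp add: power_numeral_reduce)
  \<comment> \<open>This fixes the constant: \<open>32 * 26244\<^sup>2\<close> is about 2.2 * 10^10,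
    below 400^4 = 2.56 * 10^10.\<close>
  also have "\<dots> \<le> 400 ^ 4 * m ^ 4" by (intro mult_right_mono) auto
  finally show ?thesis .
qed

lemma power_bound:
  assumes fin: "finite A" and nz: "0 \<notin> A"
  shows "real (card A) ^ 5
      \<le> 400 ^ 4 * real (max (card (sumset A A)) (card (sumset (recip_set A) (recip_set A)))) ^ 4"
    and "real (card A) ^ 5 \<le> 400 ^ 4 * real (card (sumset A (recip_set A))) ^ 4"
proof -
  let ?first = "real (card A) ^ 5
      \<le> 400 ^ 4 * real (max (card (sumset A A)) (card (sumset (recip_set A) (recip_set A)))) ^ 4"
  let ?second = "real (card A) ^ 5 \<le> 400 ^ 4 * real (card (sumset A (recip_set A))) ^ 4"
  have sep_imp: "?first \<and> ?second" if "B \<subseteq> A" "separated B" "card A \<le> 2 * card B" for B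
  proof
    show ?second using separated_case(2)[OF fin nz that] .
    show ?first
      by (rule order_trans[OF separated_case(1)[OF fin nz that]])
        (intro mult_left_mono power_mono; simp)
  qed
  have "?first \<and> ?second"
  proof (cases "card A \<le> 1")
    case True
    \<comment> \<open>Without two points there is no nearest neighbour, but separation holds
      vacuously.\<close>
    then have "\<forall>x\<in>A. \<forall>y\<in>A. x = y" using fin by (metis card_le_Suc0_iff_eq One_nat_def)
    then have "separated A" by (auto simp: separated_def)
    then show ?thesis by (intro sep_imp) auto
  next
    case False
    define nn where "nn a = arg_min_on (dist a) (A - {a})" for a
    have other: "finite (A - {a})" "A - {a} \<noteq> {}" if "a \<in> A" for a
    proof -
      show "finite (A - {a})" using fin by simp
      have "card (A - {a}) > 0" using False that fin by simp
      then show "A - {a} \<noteq> {}" by force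
    qed
    have nn: "nn a \<in> A \<and> nn a \<noteq> a" if "a \<in> A" for a
      unfolding nn_def using arg_min_if_finite(1)[OF other[OF that]] by blast
    have nearest: "dist a (nn a) \<le> dist a a'" if "a \<in> A" "a' \<in> A" "a \<noteq> a'" for a a'
      unfolding nn_def using arg_min_least[OF other[OF that(1)], of a' "dist a"] that by auto
    define P where "P = {a \<in> A. dist a (nn a) \<le> norm a / 2}"
    define B where "B = {a \<in> A. \<not> dist a (nn a) \<le> norm a / 2}"
    have "card A = card (P \<union> B)" by (rule arg_cong[of _ _ card]) (auto simp: P_def B_def)
    then have AB: "card A \<le> card P + card B" by (simp add: card_Un_le)
    show ?thesis
    proof (cases "card A \<le> 2 * card B")
      case True
      \<comment> \<open>The nearest neighbour is taken in all of \<open>A\<close>, so points of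
        \<open>B\<close> are at least as far from each other.\<close>
      have "separated B"
        unfolding separated_def
      proof (intro ballI impI)
        fix x x' assume "x \<in> B" "x' \<in> B" "x \<noteq> x'"
        then show "norm x \<le> 2 * dist x x'"
          using nearest[of x x'] by (auto simp: B_def)
      qed
      then show ?thesis using True by (intro sep_imp) (auto simp: B_def)
    next
      case False
      then have half: "real (card A) \<le> 2 * real (card P)" using AB by linarith
      have bound: "real (card P) ^ 3 * real (card D) * real (card D')
        \<le> 4 * 26244 ^ 2 * (real (card (sumset A D)) * real (card (sumset (recip_set A) D'))) ^ 2"
        if "finite D" "finite D'" for D D'
        by (rule clustered_bound[OF fin that nz, of nn]) (use nn nearest in \<open>auto simp: P_def\<close>)
      have finR: "finite (recip_set A)" using fin by (rule finite_recip_set)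
      have ?first
        using bound[OF fin finR] half unfolding card_recip_set
        by (intro power_bound_of_product[where p = "real (card P)"]) auto
      \<comment> \<open>With \<open>D = 1/A\<close> and \<open>D' = A\<close> both sumsets in the
        bound become \<open>A + 1/A\<close>.\<close>
      moreover have ?second
        using bound[OF finR fin] half unfolding card_recip_set sumset_commute[of "recip_set A"]
        by (intro power_bound_of_product[where p = "real (card P)"]) auto
      ultimately show ?thesis by blast
    qed
  qed
  then show ?first ?second by blast+
qed

theorem theorem7p2:
  shows "\<exists>c::real. c > 0 \<and>
    (\<forall>A :: complex set. finite A \<longrightarrow> 0 \<notin> A \<longrightarrow>
       real (max (card (sumset A A)) (card (sumset (recip_set A) (recip_set A))))
         \<ge> c * real (card A) powr (5/4)
     \<and> real (card (sumset A (recip_set A))) \<ge> c * real (card A) powr (5/4))"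
proof (intro exI[of _ "1/400"] conjI allI impI)
  fix A :: "complex set"
  assume "finite A" "0 \<notin> A"
  note bounds = power_bound[OF this]
  show "real (max (card (sumset A A)) (card (sumset (recip_set A) (recip_set A))))
      \<ge> 1/400 * real (card A) powr (5/4)"
    by (rule powr_bound_of_power_bound[OF bounds(1)])
  show "real (card (sumset A (recip_set A))) \<ge> 1/400 * real (card A) powr (5/4)"
    by (rule powr_bound_of_power_bound[OF bounds(2)])
qed simp

end
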